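(* Let $q$ be an odd prime power and $0<u\le 1$. Define a random sequence of non-negative integers $\lambda_1',\lambda_2',\lambda_3',\ldots$ as follows: $\lambda_1'$ is distributed as $P_{Sp,u}$; then, in succession for $i=1,2,3,\ldots$, given that $\lambda_i'=a$ (and given the earlier values), set $\lambda_{i+1}'=b$ with probability $K_1(a,b)$ if $i$ is odd, and with probability $K_2(a,b)$ if $i$ is even. Then the resulting partition $\lambda$ (the one whose column lengths are $\lambda_1'\ge\lambda_2'\ge\cdots$) is distributed according to $M_{Sp,u}$; that is, each partition $\lambda$ arises with probability $M_{Sp,u}(\lambda)$.
   Context: For a partition $\lambda$, $m_i=m_i(\lambda)$ is the number of parts equal to $i$, $\lambda_i'=m_i+m_{i+1}+\cdots$ is the length of the $i$-th column of its diagram, and $|\lambda|$ is the sum of its parts. The measure $M_{Sp,u}$ on the set of all partitions of all non-negative integers: $M_{Sp,u}(\lambda)=0$ unless every odd part of $\lambda$ has even multiplicity, in which case $$M_{Sp,u}(\lambda)=\prod_{r=1}^{\infty}\Bigl(1-\frac{u^2}{q^{2r-1}}\Bigr)\,\frac{u^{|\lambda|}}{q^{\frac12\left[\sum_i(\lambda_i')^2-\sum_i m_i^2\right]}\prod_{i\ge1}a_i},$$ where - if $i$ is odd: $a_i=q^{m_i^2/4}\prod_{l=1}^{m_i/2}(q^{2l}-1)$; - if $i$ is even and $m_i$ is even: $a_i=q^{m_i^2/4-m_i/2}\prod_{l=1}^{m_i/2}(q^{2l}-1)$; - if $i$ is even and $m_i$ is odd: $a_i=q^{(m_i^2+1)/4}\prod_{l=1}^{(m_i-1)/2}(q^{2l}-1)$.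 $P_{Sp,u}(a)$ denotes the $M_{Sp,u}$-measure of the set of partitions with exactly $a$ parts (i.e. with $\lambda_1'=a$). It equals $P_{Sp,u}(a)=\prod_{r\ge1}(1-u^2/q^{2r-1})\,P'_{Sp,u}(a)$, where for $k\ge0$ $$P'_{Sp,u}(2k)=\frac{u^{2k}}{q^{2k^2+k}\prod_{i=1}^{k}(1-u^2/q^{2i-1})(1-1/q^{2i})},\qquad P'_{Sp,u}(2k+1)=\frac{u^{2k+2}}{q^{2k^2+3k+1}\prod_{i=1}^{k+1}(1-u^2/q^{2i-1})\prod_{i=1}^{k}(1-1/q^{2i})}.$$ Also set, for $k\ge 0$, $$P'_{O,u}(2k)=\frac{u^{2k}}{q^{2k^2-k}\prod_{i=1}^{k}(1-u^2/q^{2i-1})(1-1/q^{2i})},\qquad P'_{O,u}(2k+1)=\frac{u^{2k+1}}{q^{2k^2+k}\prod_{i=1}^{k+1}(1-u^2/q^{2i-1})\prod_{i=1}^{k}(1-1/q^{2i})}.$$ The Markov chains $K_1,K_2$ on $\{0,1,2,\ldots\}$ have $K_1(a,b)=K_2(a,b)=0$ for $b>a$, and for $b\le a$: $$K_1(a,b)=\begin{cases}\dfrac{u^a P'_{O,u}(b)}{P'_{Sp,u}(a)\,q^{\frac{a^2-b^2+2(a+1)b}{4}}\,(q^{a-b}-1)\cdots(q^4-1)(q^2-1)} & a-b\text{ even},\\[2ex] 0 & a-b\text{ odd},\end{cases}$$ $$K_2(a,b)=\begin{cases}\dfrac{u^a P'_{Sp,u}(b)\,q^{(a-b)^2/4}}{P'_{O,u}(a)\,q^{\frac{a^2+b}{2}-a}\,(q^{a-b}-1)\cdots(q^4-1)(q^2-1)}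 & a-b\text{ even},\\[2ex] \dfrac{u^a P'_{Sp,u}(b)\,q^{((a-b)^2-1)/4}}{P'_{O,u}(a)\,q^{\frac{a^2-a}{2}}\,(q^{a-b-1}-1)\cdots(q^4-1)(q^2-1)} & a-b\text{ odd}.\end{cases}$$ The products of factors $q^{2l}-1$ are empty (equal to $1$) when $a-b=0$, respectively $a-b=1$. $P_{Sp,u}$ sums to one, as do the rows of $K_1$ and $K_2$. *)

theory Defs
  imports
    "HOL-Probability.Probability"
    "HOL-Number_Theory.Prime_Powers"
    "HOL-Library.Multiset"
begin

text \<open>A partition is the multiset of its (positive) parts, so that \<open>m\<^sub>i(\<mu>) = count \<mu> i\<close>
  and \<open>|\<mu>| = sum_mset \<mu>\<close>.\<close>

definition is_partition :: "nat multiset \<Rightarrow> bool" where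
  "is_partition \<mu> \<longleftrightarrow> 0 \<notin># \<mu>"

text \<open>\<open>col \<mu> i\<close> is the column length \<open>\<mu>'\<^sub>i = m\<^sub>i + m\<^sub>i\<^sub>+\<^sub>1 + \<dots>\<close>, for \<open>i \<ge> 1\<close>.\<close>

definition col :: "nat multiset \<Rightarrow> nat \<Rightarrow> nat" where
  "col \<mu> i = size {#j \<in># \<mu>. i \<le> j#}"

text \<open>\<open>evprod q n = (q^(2n) - 1) \<cdots> (q^4 - 1)(q^2 - 1)\<close>\<close>

definition evprod :: "real \<Rightarrow> nat \<Rightarrow> real" where
  "evprod q n = (\<Prod>l=1..n. q ^ (2 * l) - 1)"

text \<open>The factor \<open>a\<^sub>i\<close> as a function of \<open>i\<close> and \<open>m = m\<^sub>i\<close>. For odd \<open>i\<close> it is only used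
  with \<open>m\<close> even.\<close>

definition a_fac :: "real \<Rightarrow> nat \<Rightarrow> nat \<Rightarrow> real" where
  "a_fac q i m =
     (if odd i then q powr (real m ^ 2 / 4) * evprod q (m div 2)
      else if even m then q powr (real m ^ 2 / 4 - real m / 2) * evprod q (m div 2)
      else q powr ((real m ^ 2 + 1) / 4) * evprod q ((m - 1) div 2))"

text \<open>The sums and the product over all \<open>i \<ge> 1\<close> are truncated at \<open>|\<mu>|\<close>: for \<open>i > |\<mu>|\<close> we have
  \<open>m\<^sub>i = \<mu>'\<^sub>i = 0\<close> and \<open>a\<^sub>i = 1\<close>. The infinite product is over \<open>r \<ge> 1\<close> in the usual
  indexing, here shifted to \<open>r \<ge> 0\<close>.\<close>

definition M_Sp_weight :: "real \<Rightarrow> real \<Rightarrow> nat multiset \<Rightarrow> real" where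
  "M_Sp_weight q u \<mu> =
     (if \<forall>i. odd i \<longrightarrow> even (count \<mu> i) then
        (\<Prod>r. 1 - u ^ 2 / q ^ (2 * r + 1)) *
        (u ^ sum_mset \<mu> /
          (q powr (1 / 2 * ((\<Sum>i=1..sum_mset \<mu>. real (col \<mu> i) ^ 2) -
                            (\<Sum>i=1..sum_mset \<mu>. real (count \<mu> i) ^ 2))) *
           (\<Prod>i=1..sum_mset \<mu>. a_fac q i (count \<mu> i))))
      else 0)"

definition M_Sp :: "real \<Rightarrow> real \<Rightarrow> nat multiset measure" where
  "M_Sp q u = point_measure {\<mu>. is_partition \<mu>} (\<lambda>\<mu>. ennreal (M_Sp_weight q u \<mu>))"

definition P_Sp :: "real \<Rightarrow> real \<Rightarrow> nat \<Rightarrow> ennreal" where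
  "P_Sp q u a = emeasure (M_Sp q u) {\<mu>. is_partition \<mu> \<and> size \<mu> = a}"

text \<open>In the next two definitions \<open>a = 2k\<close> or \<open>a = 2k + 1\<close>.\<close>

definition P'_Sp :: "real \<Rightarrow> real \<Rightarrow> nat \<Rightarrow> real" where
  "P'_Sp q u a = (let k = a div 2 in
     if even a then
       u ^ (2 * k) /
         (q ^ (2 * k ^ 2 + k) * (\<Prod>i=1..k. (1 - u ^ 2 / q ^ (2 * i - 1)) * (1 - 1 / q ^ (2 * i))))
     else
       u ^ (2 * k + 2) /
         (q ^ (2 * k ^ 2 + 3 * k + 1) * (\<Prod>i=1..k + 1. 1 - u ^ 2 / q ^ (2 * i - 1)) *
          (\<Prod>i=1..k. 1 - 1 / q ^ (2 * i))))"

definition P'_O :: "real \<Rightarrow> real \<Rightarrow> nat \<Rightarrow> real" where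
  "P'_O q u a = (let k = a div 2 in
     if even a then
       u ^ (2 * k) /
         (q ^ (2 * k ^ 2 - k) * (\<Prod>i=1..k. (1 - u ^ 2 / q ^ (2 * i - 1)) * (1 - 1 / q ^ (2 * i))))
     else
       u ^ (2 * k + 1) /
         (q ^ (2 * k ^ 2 + k) * (\<Prod>i=1..k + 1. 1 - u ^ 2 / q ^ (2 * i - 1)) *
          (\<Prod>i=1..k. 1 - 1 / q ^ (2 * i))))"

definition K1 :: "real \<Rightarrow> real \<Rightarrow> nat \<Rightarrow> nat \<Rightarrow> real" where
  "K1 q u a b =
     (if b \<le> a \<and> even (a - b) then
        u ^ a * P'_O q u b /
          (P'_Sp q u a *
           q powr ((real a ^ 2 - real b ^ 2 + 2 * (real a + 1) * real b) / 4) *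
           evprod q ((a - b) div 2))
      else 0)"

definition K2 :: "real \<Rightarrow> real \<Rightarrow> nat \<Rightarrow> nat \<Rightarrow> real" where
  "K2 q u a b =
     (if b > a then 0
      else if even (a - b) then
        u ^ a * P'_Sp q u b * q powr ((real a - real b) ^ 2 / 4) /
          (P'_O q u a * q powr ((real a ^ 2 + real b) / 2 - real a) *
           evprod q ((a - b) div 2))
      else
        u ^ a * P'_Sp q u b * q powr (((real a - real b) ^ 2 - 1) / 4) /
          (P'_O q u a * q powr ((real a ^ 2 - real a) / 2) *
           evprod q ((a - b - 1) div 2)))"

end

theory Submission
  imports Defs
begin

text \<open>The weight \<open>M_Sp\<close> is the infinite product \<open>C\<close> times a product of local factors \<open>w\<^sub>i(a, b)\<close>
  over consecutive columns, and the kernels are of the form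
  \<open>K\<^sub>i(a, b) = w\<^sub>i(a, b) g\<^sub>i\<^sub>+\<^sub>1(b) / g\<^sub>i(a)\<close>. The quotients telescope, so the path of a partition with
  \<open>a\<close> parts has probability \<open>P_Sp(a) / (C P'_Sp(a))\<close> times its weight. A positive state is
  left with a fixed positive probability at even times, so almost every path is the path of a
  partition. Hence both the path probabilities and the weights of all partitions with \<open>a\<close> parts
  sum to \<open>P_Sp(a)\<close>. So the factor is \<open>1\<close>, and no \<open>q\<close>-series identity is needed for
  \<open>P_Sp(a) = C P'_Sp(a)\<close>.\<close>

section \<open>Time-inhomogeneous Markov chains on the natural numbers: path probabilities and
  absorption at 0\<close>

locale inhomogeneous_chain = prob_space M for M :: "'w measure" +
  fixes X :: "nat \<Rightarrow> 'w \<Rightarrow> nat" and p :: "nat \<Rightarrow> nat \<Rightarrow> nat \<Rightarrow> real"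
  assumes measurable_X: "i \<ge> 1 \<Longrightarrow> X i \<in> measurable M (count_space UNIV)"
    and transition: "i \<ge> 1 \<Longrightarrow> \<P>(\<omega> in M. \<forall>j\<in>{1..i}. X j \<omega> = x j) > 0 \<Longrightarrow>
      \<P>(\<omega> in M. X (i + 1) \<omega> = b \<bar> \<forall>j\<in>{1..i}. X j \<omega> = x j) = p i (x i) b"
begin

definition cyl :: "nat \<Rightarrow> (nat \<Rightarrow> nat) \<Rightarrow> 'w set" where
  "cyl i x = {\<omega> \<in> space M. \<forall>j\<in>{1..i}. X j \<omega> = x j}"

definition traj :: "(nat \<Rightarrow> nat) \<Rightarrow> 'w set" where
  "traj x = {\<omega> \<in> space M. \<forall>i\<ge>1. X i \<omega> = x i}"

lemma level_set_measurable: "i \<ge> 1 \<Longrightarrow> {\<omega> \<in> space M. X i \<omega> = a} \<in> sets M"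
  using measurable_sets[OF measurable_X, of i "{a}"] by (simp add: vimage_def Int_def conj_commute)

lemma cyl_measurable [measurable]: "cyl i x \<in> sets M"
  unfolding cyl_def by (intro sets.sets_Collect_finite_All) (auto intro: level_set_measurable)

text \<open>If \<open>cyl i x\<close> is null, \<open>transition\<close> gives no information, but
  then both sides vanish because the cylinders decrease.\<close>

lemma prob_cyl_Suc:
  assumes "i \<ge> 1"
  shows "prob (cyl (Suc i) x) = prob (cyl i x) * p i (x i) (x (Suc i))"
proof -
  have eq: "{\<omega> \<in> space M. X (i + 1) \<omega> = x (Suc i) \<and> (\<forall>j\<in>{1..i}. X j \<omega> = x j)} = cyl (Suc i) x"
    by (auto simp: cyl_def le_Suc_eq)
  show ?thesis
  proof (cases "prob (cyl i x) > 0")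
    case True
    then show ?thesis
      using transition[OF assms, of x "x (Suc i)"] eq
      by (simp add: cond_prob_def cyl_def field_simps)
  next
    case False
    then have "prob (cyl i x) = 0" by (simp add: zero_less_measure_iff)
    moreover have "prob (cyl (Suc i) x) \<le> prob (cyl i x)"
      by (rule finite_measure_mono[OF _ cyl_measurable]) (auto simp: cyl_def)
    ultimately show ?thesis by (simp add: measure_le_0_iff)
  qed
qed

lemma prob_cyl: "prob (cyl (Suc n) x) = prob (cyl 1 x) * (\<Prod>i=1..n. p i (x i) (x (Suc i)))"
  by (induction n) (simp_all add: prob_cyl_Suc)

lemma decseq_cyl: "decseq (\<lambda>n. cyl n x)"
  by (auto simp: decseq_def cyl_def)

lemma traj_eq: "traj x = (\<Inter>n. cyl n x)"
  by (fastforce simp: traj_def cyl_def)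

lemma traj_measurable [measurable]: "traj x \<in> sets M"
  unfolding traj_eq by measurable

lemma prob_cyl_LIMSEQ: "(\<lambda>n. prob (cyl n x)) \<longlonglongrightarrow> prob (traj x)"
  unfolding traj_eq by (rule finite_Lim_measure_decseq) (auto simp: decseq_cyl)

text \<open>For the columns of a partition this reduces an infinite path to a finite one: past the
  last column the chain stays at 0 with probability 1.\<close>

lemma prob_traj_eq_cyl:
  assumes "n \<ge> 1" "\<And>i. i \<ge> n \<Longrightarrow> p i (x i) (x (Suc i)) = 1"
  shows "prob (traj x) = prob (cyl n x)"
proof (rule LIMSEQ_unique[OF prob_cyl_LIMSEQ])
  have const: "prob (cyl (k + n) x) = prob (cyl n x)" for k
    using assms by (induction k) (simp_all add: prob_cyl_Suc)
  show "(\<lambda>n. prob (cyl n x)) \<longlonglongrightarrow> prob (cyl n x)"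
    by (rule LIMSEQ_offset[where k = n]) (simp add: const)
qed

text \<open>At each even time \<open>i \<ge> N\<close> a proportion \<open>\<epsilon>\<close> of \<open>cyl i x\<close> escapes to \<open>b\<close>, so
  the probabilities of the cylinders cannot converge to a positive limit.\<close>

lemma prob_traj_stuck:
  assumes stuck: "\<And>i. i \<ge> N \<Longrightarrow> x i = a" and "b \<noteq> a" and "\<epsilon> > 0"
    and escape: "\<And>i. even i \<Longrightarrow> i \<ge> 1 \<Longrightarrow> p i a b = \<epsilon>"
  shows "prob (traj x) = 0"
proof -
  have step: "\<epsilon> * prob (cyl (2 * k) x) \<le> prob (cyl (2 * k) x) - prob (cyl (Suc (2 * k)) x)"
    if "k \<ge> Suc N" for k
  proof -
    \<comment> \<open>\<open>y\<close> leaves \<open>x\<close> at time \<open>2 * k + 1\<close> by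
      jumping to \<open>b\<close>: the two paths share the cylinder up to time \<open>2 * k\<close>,
      and their next cylinders are disjoint inside it. The bound on \<open>k\<close> gives both
      \<open>2 * k >= N\<close> and \<open>2 * k >= 1\<close>.\<close>
    define y where "y = x(Suc (2 * k) := b)"
    have "cyl (2 * k) y = cyl (2 * k) x" by (auto simp: cyl_def y_def)
    moreover have "y (2 * k) = a" "y (Suc (2 * k)) = b" using that stuck by (auto simp: y_def)
    ultimately have y: "prob (cyl (Suc (2 * k)) y) = prob (cyl (2 * k) x) * \<epsilon>"
      using prob_cyl_Suc[of "2 * k" y] escape[of "2 * k"] that by simp
    have "x (Suc (2 * k)) = a" using that stuck by simp
    then have "cyl (Suc (2 * k)) x \<inter> cyl (Suc (2 * k)) y = {}"
      using \<open>b \<noteq> a\<close> by (auto simp: cyl_def y_def)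
    then have "prob (cyl (Suc (2 * k)) x) + prob (cyl (Suc (2 * k)) y) =
        prob (cyl (Suc (2 * k)) x \<union> cyl (Suc (2 * k)) y)"
      by (simp add: finite_measure_Union)
    also have "\<dots> \<le> prob (cyl (2 * k) x)"
      by (rule finite_measure_mono[OF _ cyl_measurable]) (auto simp: cyl_def y_def)
    finally show ?thesis by (simp add: y mult.commute[of \<epsilon>])
  qed
  have lim: "(\<lambda>k. prob (cyl (2 * k) x)) \<longlonglongrightarrow> prob (traj x)"
    "(\<lambda>k. prob (cyl (Suc (2 * k)) x)) \<longlonglongrightarrow> prob (traj x)"
    using LIMSEQ_subseq_LIMSEQ[OF prob_cyl_LIMSEQ, of "\<lambda>k. 2 * k" x]
      LIMSEQ_subseq_LIMSEQ[OF prob_cyl_LIMSEQ, of "\<lambda>k. Suc (2 * k)" x]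
    by (auto simp: strict_mono_def o_def)
  \<comment> \<open>The even and the odd subsequence have the same limit, so the right-hand side of
    \<open>step\<close> tends to 0.\<close>
  have "\<epsilon> * prob (traj x) \<le> prob (traj x) - prob (traj x)"
    by (rule LIMSEQ_le[OF tendsto_mult_left[OF lim(1)] tendsto_diff[OF lim]]) (use step in blast)
  then show ?thesis using \<open>\<epsilon> > 0\<close> by (simp add: mult_le_0_iff measure_le_0_iff)
qed

text \<open>A forbidden transition after a fixed history is a null event. Indexing histories by
  lists instead of functions leaves only countably many such events to exclude.\<close>

lemma AE_transition: "AE \<omega> in M. \<forall>i\<ge>1. p i (X i \<omega>) (X (Suc i) \<omega>) \<noteq> 0"
proof -
  have "AE \<omega> in M. p i (xs ! i) (xs ! Suc i) = 0 \<longrightarrow> \<omega> \<notin> cyl (Suc i) (nth xs)"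
    if "i \<ge> 1" for i and xs :: "nat list"
  proof (cases "p i (xs ! i) (xs ! Suc i) = 0")
    case True
    then have "prob (cyl (Suc i) (nth xs)) = 0" using prob_cyl_Suc[OF that] by simp
    then show ?thesis by (simp add: prob_eq_0)
  qed simp
  then have "AE \<omega> in M. \<forall>i xs. i \<ge> 1 \<longrightarrow> p i (xs ! i) (xs ! Suc i) = 0 \<longrightarrow>
      \<omega> \<notin> cyl (Suc i) (nth xs)"
    by (simp add: AE_all_countable)
  with AE_space show ?thesis
  proof eventually_elim
    case (elim \<omega>)
    show ?case
    proof (intro allI impI)
      fix i :: nat
      assume i: "i \<ge> 1"
      \<comment> \<open>Entry 0 is a filler, since cylinders constrain only times from 1 on; length
        \<open>i + 2\<close> makes index \<open>Suc i\<close> valid.\<close>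
      define xs where "xs = map (\<lambda>j. X j \<omega>) [0..<i + 2]"
      have nth: "xs ! j = X j \<omega>" if "j \<le> Suc i" for j
        using that unfolding xs_def by (subst nth_map) (simp_all del: upt_Suc)
      then have "\<omega> \<in> cyl (Suc i) (nth xs)" using elim(1) by (simp add: cyl_def)
      with elim(2) i have "p i (xs ! i) (xs ! Suc i) \<noteq> 0" by blast
      then show "p i (X i \<omega>) (X (Suc i) \<omega>) \<noteq> 0" by (simp add: nth)
    qed
  qed
qed

text \<open>A sequence that is eventually \<open>a\<close> is determined by a finite list, so there
  are countably many of them, and each is a null path by \<open>prob_traj_stuck\<close>.\<close>

lemma AE_not_stuck:
  assumes "b \<noteq> a" "\<epsilon> > 0" "\<And>i. even i \<Longrightarrow> i \<ge> 1 \<Longrightarrow> p i a b = \<epsilon>"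
  shows "AE \<omega> in M. \<forall>N. \<exists>i\<ge>N. X i \<omega> \<noteq> a"
proof -
  define ext where "ext xs i = (if i < length xs then xs ! i else a)" for xs i
  have "AE \<omega> in M. \<omega> \<notin> traj (ext xs)" for xs
  proof -
    have "prob (traj (ext xs)) = 0"
      by (rule prob_traj_stuck[where N = "length xs", OF _ assms]) (auto simp: ext_def)
    then show ?thesis by (simp add: prob_eq_0)
  qed
  then have "AE \<omega> in M. \<forall>xs. \<omega> \<notin> traj (ext xs)"
    by (simp add: AE_all_countable)
  with AE_space show ?thesis
  proof eventually_elim
    case (elim \<omega>)
    show ?case
    proof (rule ccontr)
      assume "\<not> (\<forall>N. \<exists>i\<ge>N. X i \<omega> \<noteq> a)"
      then obtain N where "\<And>i. i \<ge> N \<Longrightarrow> X i \<omega> = a" by blast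
      then have "\<omega> \<in> traj (ext (map (\<lambda>j. X j \<omega>) [0..<N]))"
        using elim(1) by (auto simp: traj_def ext_def)
      with elim(2) show False by blast
    qed
  qed
qed

text \<open>A nonincreasing sequence of naturals becomes constant at its minimum, and
  \<open>AE_not_stuck\<close> with \<open>b = a - 1\<close> excludes every positive minimum.\<close>

lemma AE_eventually_0:
  assumes mono: "\<And>i a b. i \<ge> 1 \<Longrightarrow> a < b \<Longrightarrow> p i a b = 0"
    and escape: "\<And>i a. even i \<Longrightarrow> i \<ge> 1 \<Longrightarrow> a > 0 \<Longrightarrow> p i a (a - 1) = \<epsilon> a"
    and pos: "\<And>a. a > 0 \<Longrightarrow> \<epsilon> a > 0"
  shows "AE \<omega> in M. (\<forall>i\<ge>1. X (Suc i) \<omega> \<le> X i \<omega>) \<and> (\<exists>N. \<forall>i\<ge>N. X i \<omega> = 0)"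
proof -
  have "AE \<omega> in M. a > 0 \<longrightarrow> (\<forall>N. \<exists>i\<ge>N. X i \<omega> \<noteq> a)" for a
  proof (cases "a > 0")
    case True
    then show ?thesis
      using AE_not_stuck[of "a - 1" a "\<epsilon> a"] escape[of _ a] pos[of a] by simp
  qed simp
  then have "AE \<omega> in M. \<forall>a. a > 0 \<longrightarrow> (\<forall>N. \<exists>i\<ge>N. X i \<omega> \<noteq> a)"
    by (simp add: AE_all_countable)
  with AE_transition show ?thesis
  proof eventually_elim
    case (elim \<omega>)
    have dec: "X (Suc i) \<omega> \<le> X i \<omega>" if "i \<ge> 1" for i
      using elim(1) mono[OF that] that by (meson not_le)
    \<comment> \<open>The minimum is over times from 1 on, because \<open>X 0\<close> is
      unconstrained.\<close>
    define a where "a = (LEAST a. \<exists>i\<ge>1. X i \<omega> = a)"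
    have "\<exists>i\<ge>1. X i \<omega> = a"
      unfolding a_def by (rule LeastI[where P = "\<lambda>a. \<exists>i\<ge>1. X i \<omega> = a"]) blast
    then obtain N where N: "N \<ge> 1" "X N \<omega> = a" by blast
    have "X i \<omega> = a" if "i \<ge> N" for i
    proof (rule antisym)
      show "X i \<omega> \<le> a"
        using that N dec by (induction i rule: dec_induct) (auto intro: order_trans)
      have "i \<ge> 1" using that N by simp
      then show "a \<le> X i \<omega>"
        unfolding a_def by (intro Least_le) blast
    qed
    moreover from this have "a = 0" using elim(2) by blast
    ultimately show ?case using dec by blast
  qed
qed

end

section \<open>Partitions described by their column lengths\<close>

lemma col_empty [simp]: "col {#} i = 0"
  by (simp add: col_def)

lemma col_add_mset: "col (add_mset x \<mu>) i = (if i \<le> x then 1 else 0) + col \<mu> i"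
  by (simp add: col_def)

lemma col_union: "col (\<mu> + \<nu>) i = col \<mu> i + col \<nu> i"
  by (simp add: col_def)

lemma col_replicate_mset: "col (replicate_mset n x) i = (if i \<le> x then n else 0)"
  by (induction n) (auto simp: col_add_mset)

lemma col_Suc: "col \<mu> i = count \<mu> i + col \<mu> (Suc i)"
  by (induction \<mu>) (auto simp: col_add_mset)

lemma col_1: "is_partition \<mu> \<Longrightarrow> col \<mu> 1 = size \<mu>"
  by (induction \<mu>) (auto simp: col_add_mset is_partition_def)

lemma col_eq_0:
  assumes "\<And>x. x \<in># \<mu> \<Longrightarrow> x < i"
  shows "col \<mu> i = 0"
  using assms by (induction \<mu>) (auto simp: col_add_mset not_le)

lemma col_gt_sum_mset: "sum_mset \<mu> < i \<Longrightarrow> col \<mu> i = 0"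
  by (rule col_eq_0) (metis sum_mset.remove le_add1 le_less_trans)

lemma sum_col:
  assumes "\<And>x. x \<in># \<mu> \<Longrightarrow> x \<le> N"
  shows "(\<Sum>i=1..N. col \<mu> i) = sum_mset \<mu>"
  using assms
proof (induction \<mu>)
  case (add x \<mu>)
  have "{1..N} \<inter> {i. i \<le> x} = {1..x}" using add.prems[of x] by auto
  then show ?case using add by (simp add: col_add_mset sum.distrib sum.If_cases)
qed simp

lemma sum_col_sum_mset: "(\<Sum>i=1..sum_mset \<mu>. col \<mu> i) = sum_mset \<mu>"
  by (rule sum_col) (metis sum_mset.remove le_add1)

text \<open>For \<open>i > 0\<close> the multiplicity of \<open>i\<close> is the difference of
  columns \<open>i\<close> and \<open>i + 1\<close>. The multiplicity of 0 is invisible to these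
  columns, but it is zero by \<open>is_partition\<close>.\<close>

lemma partition_eqI:
  assumes "is_partition \<mu>" "is_partition \<nu>" and eq: "\<And>i. i \<ge> 1 \<Longrightarrow> col \<mu> i = col \<nu> i"
  shows "\<mu> = \<nu>"
proof (rule multiset_eqI)
  fix i
  show "count \<mu> i = count \<nu> i"
  proof (cases "i = 0")
    case True
    then show ?thesis using assms(1,2) by (simp add: is_partition_def not_in_iff)
  next
    case False
    then show ?thesis using eq[of i] eq[of "Suc i"] col_Suc[of \<mu> i] col_Suc[of \<nu> i] by simp
  qed
qed

text \<open>Induction on the number of columns: cut off the \<open>c (Suc N)\<close> rows of full
  length \<open>Suc N\<close>, which leaves at most \<open>N\<close> columns, and put them back as
  parts equal to \<open>Suc N\<close>.\<close>

lemma ex_partition_col: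
  assumes "\<And>i. i \<ge> 1 \<Longrightarrow> c (Suc i) \<le> c i" and "\<And>i. i > N \<Longrightarrow> c i = 0"
  shows "\<exists>\<mu>. is_partition \<mu> \<and> (\<forall>i\<ge>1. col \<mu> i = c i)"
  using assms
proof (induction N arbitrary: c)
  case 0
  then show ?case by (intro exI[of _ "{#}"]) (auto simp: is_partition_def)
next
  case (Suc N)
  define d where "d i = (if i \<le> N then c i - c (Suc N) else 0)" for i
  have mono: "c (Suc N) \<le> c i" if "1 \<le> i" "i \<le> Suc N" for i
    using that(2,1)
  proof (induction i rule: inc_induct)
    case (step n)
    then show ?case using Suc.prems(1)[of n] by simp
  qed simp
  have "\<exists>\<mu>. is_partition \<mu> \<and> (\<forall>i\<ge>1. col \<mu> i = d i)"
    by (rule Suc.IH) (use Suc.prems(1) in \<open>auto simp: d_def diff_le_mono\<close>)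
  then obtain \<mu> where \<mu>: "is_partition \<mu>" "\<And>i. i \<ge> 1 \<Longrightarrow> col \<mu> i = d i" by blast
  have "col (\<mu> + replicate_mset (c (Suc N)) (Suc N)) i = c i" if "i \<ge> 1" for i
    using \<mu>(2)[OF that] mono[OF that] Suc.prems(2)[of i] that
    by (cases "i = Suc N") (auto simp: col_union col_replicate_mset d_def)
  moreover have "is_partition (\<mu> + replicate_mset (c (Suc N)) (Suc N))"
    using \<mu>(1) by (auto simp: is_partition_def)
  ultimately show ?case by blast
qed

lemma countable_multiset: "countable (A :: 'a :: countable multiset set)"
proof -
  have "countable (range (mset :: 'a list \<Rightarrow> _))" by (rule countable_image) simp
  then show ?thesis by (rule countable_subset[rotated]) (metis ex_mset subsetI rangeI)
qed

section \<open>Factorization of the weight over consecutive columns\<close>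

text \<open>The factor of \<open>M_Sp\<close> contributed by a column of length \<open>a\<close> in position \<open>i\<close>
  that is followed by a column of length \<open>b\<close>.\<close>

definition col_weight :: "real \<Rightarrow> real \<Rightarrow> nat \<Rightarrow> nat \<Rightarrow> nat \<Rightarrow> real" where
  "col_weight q u i a b =
     (if odd i \<and> odd (a - b) then 0
      else u ^ a / (q powr ((real a ^ 2 - real (a - b) ^ 2) / 2) * a_fac q i (a - b)))"

text \<open>Multiplicities are differences of consecutive columns and the columns add up to
  \<open>sum_mset \<mu>\<close>, so the powers of \<open>u\<close> and of \<open>q\<close> split
  column by column.\<close>

lemma M_Sp_weight_prod:
  assumes "q > 0" "is_partition \<mu>"
  shows "M_Sp_weight q u \<mu> = (\<Prod>r. 1 - u ^ 2 / q ^ (2 * r + 1)) *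
           (\<Prod>i=1..sum_mset \<mu>. col_weight q u i (col \<mu> i) (col \<mu> (Suc i)))"
proof (cases "\<forall>i. odd i \<longrightarrow> even (count \<mu> i)")
  case True
  let ?n = "sum_mset \<mu>"
  have diff: "col \<mu> i - col \<mu> (Suc i) = count \<mu> i" for i
    using col_Suc[of \<mu> i] by simp
  have "q powr (1 / 2 * ((\<Sum>i=1..?n. real (col \<mu> i) ^ 2) - (\<Sum>i=1..?n. real (count \<mu> i) ^ 2))) =
      (\<Prod>i=1..?n. q powr ((real (col \<mu> i) ^ 2 - real (count \<mu> i) ^ 2) / 2))"
    using \<open>q > 0\<close>
    by (subst powr_sum[symmetric]) (simp_all add: sum_subtractf flip: sum_divide_distrib)
  moreover have "u ^ ?n = (\<Prod>i=1..?n. u ^ col \<mu> i)"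
    by (simp only: power_sum[symmetric] sum_col_sum_mset)
  moreover have "col_weight q u i (col \<mu> i) (col \<mu> (Suc i)) = u ^ col \<mu> i /
      (q powr ((real (col \<mu> i) ^ 2 - real (count \<mu> i) ^ 2) / 2) * a_fac q i (count \<mu> i))" for i
    unfolding col_weight_def diff using True by auto
  ultimately show ?thesis using True
    by (simp add: M_Sp_weight_def prod.distrib prod_dividef)
next
  case False
  then obtain i where i: "odd i" "odd (count \<mu> i)" by blast
  \<comment> \<open>The offending \<open>i\<close> is a part, hence at most
    \<open>sum_mset \<mu>\<close>, so its zero factor does occur in the truncated product.\<close>
  then have "i \<in># \<mu>" by (metis count_eq_zero_iff even_zero)
  then have "i \<in> {1..sum_mset \<mu>}"
    using i(1) by (auto simp: sum_mset.remove odd_pos Suc_le_eq)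
  moreover have "col_weight q u i (col \<mu> i) (col \<mu> (Suc i)) = 0"
    using i col_Suc[of \<mu> i] by (simp add: col_weight_def)
  ultimately have "(\<Prod>i=1..sum_mset \<mu>. col_weight q u i (col \<mu> i) (col \<mu> (Suc i))) = 0"
    by (intro prod_zero) auto
  then show ?thesis unfolding M_Sp_weight_def if_not_P[OF False] by simp
qed

section \<open>Positivity of the factors\<close>

lemma evprod_pos: "q > 1 \<Longrightarrow> evprod q n > 0"
  unfolding evprod_def by (intro prod_pos) (auto intro!: one_less_power)

lemma a_fac_pos: "q > 1 \<Longrightarrow> a_fac q i m > 0"
  using evprod_pos[of q] by (simp add: a_fac_def)

lemma col_weight_nonneg: "q > 1 \<Longrightarrow> u \<ge> 0 \<Longrightarrow> col_weight q u i a b \<ge> 0"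
  using a_fac_pos[of q i "a - b"] by (simp add: col_weight_def)

lemma one_minus_pos:
  fixes q u :: real
  assumes "q > 1" "\<bar>u\<bar> \<le> 1" "n > 0"
  shows "0 < 1 - u ^ 2 / q ^ n"
proof -
  have "u ^ 2 \<le> 1" using assms(2) by (simp add: abs_square_le_1)
  also have "1 < q ^ n" using assms by simp
  finally show ?thesis using assms by simp
qed

lemma
  assumes "q > 1" "0 < u" "u \<le> 1"
  shows P'_Sp_pos: "P'_Sp q u a > 0" and P'_O_pos: "P'_O q u a > 0"
proof -
  have *: "0 < 1 - u ^ 2 / q ^ (2 * i - 1)" "0 < 1 - 1 / q ^ (2 * i)" if "i \<ge> 1" for i
    using one_minus_pos[of q u "2 * i - 1"] one_minus_pos[of q 1 "2 * i"] assms that by auto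
  have prods: "0 < (\<Prod>i=1..k. (1 - u ^ 2 / q ^ (2 * i - 1)) * (1 - 1 / q ^ (2 * i)))"
    "0 < (\<Prod>i=1..k. 1 - u ^ 2 / q ^ (2 * i - 1))" "0 < (\<Prod>i=1..k. 1 - 1 / q ^ (2 * i))" for k
    using * by (auto intro!: prod_pos mult_pos_pos simp del: One_nat_def)
  show "P'_Sp q u a > 0" "P'_O q u a > 0"
    unfolding P'_Sp_def P'_O_def Let_def using assms(1,2)
    by (auto intro!: divide_pos_pos mult_pos_pos prods zero_less_power simp del: One_nat_def)
qed

section \<open>The kernels as conjugates of the column weights\<close>

definition K :: "real \<Rightarrow> real \<Rightarrow> nat \<Rightarrow> nat \<Rightarrow> nat \<Rightarrow> real" where
  "K q u i = (if odd i then K1 q u else K2 q u)"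

text \<open>The power of \<open>q\<close> makes up for the difference between the exponents in \<open>K1\<close>, \<open>K2\<close> and
  those in \<open>M_Sp\<close>; it cancels over two consecutive steps.\<close>

definition gauge :: "real \<Rightarrow> real \<Rightarrow> nat \<Rightarrow> nat \<Rightarrow> real" where
  "gauge q u i a = (if odd i then P'_Sp q u a else P'_O q u a * q powr (- real a / 2))"

lemma gauge_0: "q > 0 \<Longrightarrow> gauge q u i 0 = 1"
  by (simp add: gauge_def P'_Sp_def P'_O_def)

text \<open>Once the values of \<open>P'_Sp\<close> and \<open>P'_O\<close>, \<open>u ^ a\<close>
  and \<open>evprod\<close> are matched, one identity between exponents of \<open>q\<close> remains
  for each parity class; it is polynomial after substituting \<open>a = b + m\<close>. For
  \<open>i\<close> and \<open>m\<close> both odd, both sides are 0.\<close>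

lemma K_gauge:
  assumes q: "q > 1" and u: "0 < u" "u \<le> 1" and "b \<le> a"
  shows "gauge q u i a * K q u i a b = gauge q u (Suc i) b * col_weight q u i a b"
proof -
  define m where "m = a - b"
  have a: "a = b + m" and ab: "real a = real b + real m"
    using \<open>b \<le> a\<close> by (simp_all add: m_def)
  have pos: "P'_Sp q u a \<noteq> 0" "P'_O q u a \<noteq> 0" "evprod q n \<noteq> 0" "q powr x \<noteq> 0" for n x
    using P'_Sp_pos[OF q u, of a] P'_O_pos[OF q u, of a] evprod_pos[OF q, of n] q by auto
  have inv: "q powr (- real c / 2) = inverse (q powr (real c / 2))" for c
    by (simp flip: powr_minus)
  \<comment> \<open>\<open>rearr\<close> serves even \<open>i\<close>, \<open>rearr1\<close> odd
    \<open>i\<close>. In both, \<open>g\<close> and \<open>p\<close> are the \<open>P'\<close>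
    values at \<open>a\<close> and \<open>b\<close>, \<open>w\<close> is \<open>u ^ a\<close>,
    \<open>e\<close> is \<open>evprod\<close>, \<open>c\<close> and \<open>d\<close> are the powers
    of \<open>q\<close> in \<open>col_weight\<close>, and \<open>inverse y\<close> is the one in
    \<open>gauge\<close>; \<open>x\<close> and \<open>z\<close> are the powers in the denominator
    and numerator of \<open>K2\<close>.\<close>
  have rearr: "(g * inverse y) * (w * p * z / (g * x * e)) = p * (w / (c * (d * e)))"
    if "x * y = c * d * z" "g \<noteq> 0" "z \<noteq> 0" "y \<noteq> 0" for g y w p z x e c d :: real
  proof -
    have "(g * inverse y) * (w * p * z / (g * x * e)) = w * p * z / (x * y * e)"
      using that(2) by (simp add: divide_inverse mult_ac)
    also have "\<dots> = p * (w / (c * (d * e)))"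
      using that(3) by (simp add: that(1) divide_inverse mult_ac)
    finally show ?thesis .
  qed
  have rearr1: "g * (w * p / (g * (y * (c * d)) * e)) = p * inverse y * (w / (c * (d * e)))"
    if "g \<noteq> 0" for g w p y c d e :: real
    using that by (simp add: divide_inverse mult_ac)
  consider "odd i" "even m" | "odd i" "odd m" | "even i" "even m" | "even i" "odd m" by blast
  then show ?thesis
  proof cases
    case 1
    have "(real a ^ 2 - real b ^ 2 + 2 * (real a + 1) * real b) / 4 =
        real b / 2 + ((real a ^ 2 - real m ^ 2) / 2 + real m ^ 2 / 4)"
      unfolding ab by (simp add: power2_eq_square field_simps)
    then have e: "q powr ((real a ^ 2 - real b ^ 2 + 2 * (real a + 1) * real b) / 4) =
        q powr (real b / 2) * (q powr ((real a ^ 2 - real m ^ 2) / 2) * q powr (real m ^ 2 / 4))"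
      by (simp only: powr_add)
    have "K q u i a b = u ^ a * P'_O q u b / (P'_Sp q u a *
        q powr ((real a ^ 2 - real b ^ 2 + 2 * (real a + 1) * real b) / 4) * evprod q (m div 2))"
      using 1 \<open>b \<le> a\<close> by (simp add: K_def K1_def m_def)
    moreover have "col_weight q u i a b = u ^ a / (q powr ((real a ^ 2 - real m ^ 2) / 2) *
        (q powr (real m ^ 2 / 4) * evprod q (m div 2)))"
      using 1 by (simp add: col_weight_def a_fac_def flip: m_def)
    ultimately show ?thesis using 1(1) pos(1)
      by (simp only: gauge_def inv e rearr1 even_Suc if_True if_False not_not simp_thms)
  next
    case 2
    then show ?thesis by (simp add: K_def K1_def col_weight_def flip: m_def)
  next
    case 3
    have "(real a ^ 2 + real b) / 2 - real a + real a / 2 =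
        (real a ^ 2 - real m ^ 2) / 2 + (real m ^ 2 / 4 - real m / 2) + (real a - real b) ^ 2 / 4"
      unfolding ab by (simp add: power2_eq_square field_simps)
    then have e: "q powr ((real a ^ 2 + real b) / 2 - real a) * q powr (real a / 2) =
        q powr ((real a ^ 2 - real m ^ 2) / 2) * q powr (real m ^ 2 / 4 - real m / 2) *
        q powr ((real a - real b) ^ 2 / 4)"
      by (simp only: powr_add[symmetric])
    have "K q u i a b = u ^ a * P'_Sp q u b * q powr ((real a - real b) ^ 2 / 4) /
        (P'_O q u a * q powr ((real a ^ 2 + real b) / 2 - real a) * evprod q (m div 2))"
      using 3 \<open>b \<le> a\<close> by (simp add: K_def K2_def m_def)
    moreover have "col_weight q u i a b = u ^ a / (q powr ((real a ^ 2 - real m ^ 2) / 2) *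
        (q powr (real m ^ 2 / 4 - real m / 2) * evprod q (m div 2)))"
      using 3 by (simp add: col_weight_def a_fac_def flip: m_def)
    ultimately show ?thesis using 3(1)
      by (simp only: gauge_def inv rearr[OF e pos(2,4,4)] even_Suc if_True if_False not_not simp_thms)
  next
    case 4
    have "(real a ^ 2 - real a) / 2 + real a / 2 =
        (real a ^ 2 - real m ^ 2) / 2 + (real m ^ 2 + 1) / 4 + ((real a - real b) ^ 2 - 1) / 4"
      unfolding ab by (simp add: power2_eq_square field_simps)
    then have e: "q powr ((real a ^ 2 - real a) / 2) * q powr (real a / 2) =
        q powr ((real a ^ 2 - real m ^ 2) / 2) * q powr ((real m ^ 2 + 1) / 4) *
        q powr (((real a - real b) ^ 2 - 1) / 4)"
      by (simp only: powr_add[symmetric])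
    have "K q u i a b = u ^ a * P'_Sp q u b * q powr (((real a - real b) ^ 2 - 1) / 4) /
        (P'_O q u a * q powr ((real a ^ 2 - real a) / 2) * evprod q ((m - 1) div 2))"
      using 4 \<open>b \<le> a\<close> by (simp add: K_def K2_def m_def)
    moreover have "col_weight q u i a b = u ^ a / (q powr ((real a ^ 2 - real m ^ 2) / 2) *
        (q powr ((real m ^ 2 + 1) / 4) * evprod q ((m - 1) div 2)))"
      using 4 by (simp add: col_weight_def a_fac_def flip: m_def)
    ultimately show ?thesis using 4(1)
      by (simp only: gauge_def inv rearr[OF e pos(2,4,4)] even_Suc if_True if_False not_not simp_thms)
  qed
qed

text \<open>Each application of \<open>K_gauge\<close> moves the gauge one column further, so only
  its values at the two ends survive.\<close>

lemma prod_K: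
  assumes "q > 1" "0 < u" "u \<le> 1" and "\<And>i. i \<ge> 1 \<Longrightarrow> c (Suc i) \<le> c i"
  shows "gauge q u 1 (c 1) * (\<Prod>i=1..n. K q u i (c i) (c (Suc i))) =
           gauge q u (Suc n) (c (Suc n)) * (\<Prod>i=1..n. col_weight q u i (c i) (c (Suc i)))"
proof (induction n)
  case (Suc n)
  let ?K = "\<lambda>i. K q u i (c i) (c (Suc i))"
  have "gauge q u 1 (c 1) * (\<Prod>i=1..Suc n. ?K i) =
      gauge q u (Suc n) (c (Suc n)) * ?K (Suc n) * (\<Prod>i=1..n. col_weight q u i (c i) (c (Suc i)))"
    using Suc.IH by (simp add: mult_ac)
  then show ?case using K_gauge[OF assms(1-3) assms(4)[of "Suc n"], of "Suc n"]
    by (simp add: mult_ac)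
qed simp

lemma K_eq_0: "a < b \<Longrightarrow> K q u i a b = 0"
  by (simp add: K_def K1_def K2_def)

lemma K_0_0: "q > 0 \<Longrightarrow> K q u i 0 0 = 1"
  by (simp add: K_def K1_def K2_def P'_Sp_def P'_O_def evprod_def)

text \<open>This is the escape that forces absorption at 0. It has to take place at even times,
  because \<open>K1\<close> allows only drops of even size.\<close>

lemma K2_step_pos:
  assumes "q > 1" "0 < u" "u \<le> 1" "a > 0"
  shows "K2 q u a (a - 1) > 0"
proof -
  have "odd (a - (a - 1))" using assms by simp
  then show ?thesis using assms
    by (simp add: K2_def P'_Sp_pos P'_O_pos evprod_pos)
qed

section \<open>Nonnegativity of the weights, and \<open>P_Sp\<close> as a sum of weights\<close>

text \<open>The infinite product is a limit of partial products only if it converges, so convergence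
  comes first; the deviations from 1 form a geometric series of ratio
  \<open>1 / q ^ 2\<close>.\<close>

lemma prodinf_M_Sp_nonneg:
  fixes q u :: real
  assumes "q > 1" "\<bar>u\<bar> \<le> 1"
  shows "(\<Prod>r. 1 - u ^ 2 / q ^ (2 * r + 1)) \<ge> 0"
proof -
  have "summable (\<lambda>r. u ^ 2 / q * (1 / q ^ 2) ^ r)"
    using assms by (intro summable_mult summable_geometric) (simp add: power_less_one_iff)
  then have "summable (\<lambda>r. norm ((1 - u ^ 2 / q ^ (2 * r + 1)) - 1))"
    using assms by (simp add: power_mult power_divide)
  then have "convergent_prod (\<lambda>r. 1 - u ^ 2 / q ^ (2 * r + 1))"
    by (intro abs_convergent_prod_imp_convergent_prod summable_imp_abs_convergent_prod)
  moreover have "0 \<le> 1 - u ^ 2 / q ^ (2 * r + 1)" for r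
    using one_minus_pos[OF assms, of "2 * r + 1"] by simp
  ultimately show ?thesis by (auto intro!: LIMSEQ_le_const[OF convergent_prod_LIMSEQ] prod_nonneg)
qed

lemma M_Sp_weight_nonneg:
  assumes "q > 1" "0 < u" "u \<le> 1" "is_partition \<mu>"
  shows "M_Sp_weight q u \<mu> \<ge> 0"
  using assms by (simp only: M_Sp_weight_prod)
    (intro mult_nonneg_nonneg prod_nonneg col_weight_nonneg prodinf_M_Sp_nonneg, auto)

lemma P_Sp_eq_nn_integral:
  "P_Sp q u a =
     (\<integral>\<^sup>+\<mu>. ennreal (M_Sp_weight q u \<mu>) \<partial>count_space {\<mu>. is_partition \<mu> \<and> size \<mu> = a})"
proof -
  have "P_Sp q u a = (\<integral>\<^sup>+\<mu>. ennreal (M_Sp_weight q u \<mu>) *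
      indicator {\<mu>. is_partition \<mu> \<and> size \<mu> = a} \<mu> \<partial>count_space {\<mu>. is_partition \<mu>})"
    unfolding P_Sp_def M_Sp_def point_measure_def by (subst emeasure_density) auto
  also have "\<dots> = (\<integral>\<^sup>+\<mu>. ennreal (M_Sp_weight q u \<mu>)
      \<partial>count_space {\<mu>. is_partition \<mu> \<and> size \<mu> = a})"
    unfolding nn_integral_count_space_indicator[of "{\<mu>. is_partition \<mu>}", simplified]
      nn_integral_count_space_indicator[of "{\<mu>. is_partition \<mu> \<and> size \<mu> = a}", simplified]
    by (intro nn_integral_cong) (auto simp: indicator_def)
  finally show ?thesis .
qed

section \<open>Comparison of the law of the chain with the partition weights\<close>

theorem theorem4:
  fixes q :: nat and u :: real
    and \<Omega> :: "'w measure" and X :: "nat \<Rightarrow> 'w \<Rightarrow> nat"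
  assumes "primepow q" and "odd q" and "0 < u" and "u \<le> 1"
    and "prob_space \<Omega>"
    and "\<And>i. i \<ge> 1 \<Longrightarrow> X i \<in> measurable \<Omega> (count_space UNIV)"
    and "\<And>a. emeasure \<Omega> {\<omega> \<in> space \<Omega>. X 1 \<omega> = a} = P_Sp (real q) u a"
    and "\<And>i (x :: nat \<Rightarrow> nat) b. i \<ge> 1 \<Longrightarrow>
           \<P>(\<omega> in \<Omega>. \<forall>j\<in>{1..i}. X j \<omega> = x j) > 0 \<Longrightarrow>
           \<P>(\<omega> in \<Omega>. X (i + 1) \<omega> = b \<bar> \<forall>j\<in>{1..i}. X j \<omega> = x j) =
             (if odd i then K1 (real q) u (x i) b else K2 (real q) u (x i) b)"
  shows "(AE \<omega> in \<Omega>. \<exists>!\<mu>. is_partition \<mu> \<and> (\<forall>i\<ge>1. col \<mu> i = X i \<omega>)) \<and>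
         (\<forall>\<mu>. is_partition \<mu> \<longrightarrow>
            \<P>(\<omega> in \<Omega>. \<forall>i\<ge>1. col \<mu> i = X i \<omega>) = M_Sp_weight (real q) u \<mu>)"
proof -
  define Q where "Q = real q"
  define C where "C = (\<Prod>r. 1 - u ^ 2 / Q ^ (2 * r + 1))"
  define S where "S a = {\<mu>. is_partition \<mu> \<and> size \<mu> = a}" for a
  note u = \<open>0 < u\<close> \<open>u \<le> 1\<close>
  have Q: "Q > 1" using primepow_gt_Suc_0[OF \<open>primepow q\<close>] by (simp add: Q_def)
  interpret prob_space \<Omega> by fact
  interpret inhomogeneous_chain \<Omega> X "K Q u"
  proof
    show "X i \<in> measurable \<Omega> (count_space UNIV)" if "i \<ge> 1" for i
      by (rule assms(6)[OF that])
    show "\<P>(\<omega> in \<Omega>. X (i + 1) \<omega> = b \<bar> \<forall>j\<in>{1..i}. X j \<omega> = x j) = K Q u i (x i) b"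
      if "i \<ge> 1" "\<P>(\<omega> in \<Omega>. \<forall>j\<in>{1..i}. X j \<omega> = x j) > 0" for i x b
      using assms(8)[OF that] by (simp add: K_def Q_def)
  qed
  define r where "r a = prob {\<omega> \<in> space \<Omega>. X 1 \<omega> = a}" for a
  have r: "P_Sp Q u a = ennreal (r a)" for a
    using assms(7)[of a] by (simp add: r_def Q_def emeasure_eq_measure)
  have partition: "AE \<omega> in \<Omega>. \<exists>\<mu>. is_partition \<mu> \<and> (\<forall>i\<ge>1. col \<mu> i = X i \<omega>)"
  proof -
    have "AE \<omega> in \<Omega>. (\<forall>i\<ge>1. X (Suc i) \<omega> \<le> X i \<omega>) \<and> (\<exists>N. \<forall>i\<ge>N. X i \<omega> = 0)"
      using K2_step_pos[OF Q u]
      by (intro AE_eventually_0[where \<epsilon> = "\<lambda>a. K2 Q u a (a - 1)"] K_eq_0) (auto simp: K_def)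
    then show ?thesis
    proof eventually_elim
      case (elim \<omega>)
      then obtain N where "\<And>i. i \<ge> N \<Longrightarrow> X i \<omega> = 0" by blast
      then show ?case using elim by (intro ex_partition_col[where N = N]) auto
    qed
  qed
  \<comment> \<open>Path probability and weight are proportional, with constants depending only on
    the number of parts. The relation is kept in product form, as neither \<open>C\<close> nor
    \<open>r\<close> has been shown to be nonzero.\<close>
  have traj_prob: "P'_Sp Q u (size \<mu>) * C * prob (traj (col \<mu>)) = r (size \<mu>) * M_Sp_weight Q u \<mu>"
    if "is_partition \<mu>" for \<mu>
  proof -
    let ?n = "sum_mset \<mu>"
    have 0: "col \<mu> i = 0" if "i > ?n" for i
      using that by (rule col_gt_sum_mset)
    \<comment> \<open>Column \<open>Suc ?n\<close> is already 0, so every later step goes from 0 to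
      0.\<close>
    have "prob (traj (col \<mu>)) = prob (cyl (Suc ?n) (col \<mu>))"
      by (rule prob_traj_eq_cyl) (use Q in \<open>auto simp: 0 K_0_0\<close>)
    also have "\<dots> = prob (cyl 1 (col \<mu>)) * (\<Prod>i=1..?n. K Q u i (col \<mu> i) (col \<mu> (Suc i)))"
      by (rule prob_cyl)
    also have "prob (cyl 1 (col \<mu>)) = r (size \<mu>)"
      using col_1[OF that] by (simp add: cyl_def r_def)
    finally have "P'_Sp Q u (size \<mu>) * prob (traj (col \<mu>)) =
        r (size \<mu>) * (gauge Q u 1 (col \<mu> 1) * (\<Prod>i=1..?n. K Q u i (col \<mu> i) (col \<mu> (Suc i))))"
      using col_1[OF that] by (simp add: gauge_def)
    also have "gauge Q u 1 (col \<mu> 1) * (\<Prod>i=1..?n. K Q u i (col \<mu> i) (col \<mu> (Suc i))) =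
        (\<Prod>i=1..?n. col_weight Q u i (col \<mu> i) (col \<mu> (Suc i)))"
    proof -
      have "col \<mu> (Suc i) \<le> col \<mu> i" for i
        using col_Suc[of \<mu> i] by simp
      moreover have "gauge Q u (Suc ?n) (col \<mu> (Suc ?n)) = 1"
        using Q by (simp only: 0[OF lessI] gauge_0)
      ultimately show ?thesis by (simp only: prod_K[OF Q u] mult_1)
    qed
    finally show ?thesis
      using Q by (simp only: M_Sp_weight_prod[OF _ that] C_def) (simp add: mult_ac)
  qed
  \<comment> \<open>Up to a null set, the event that \<open>X 1\<close> equals \<open>a\<close> is
    the countable disjoint union of the paths of the partitions with \<open>a\<close> parts.\<close>
  have first_col: "ennreal (r a) = (\<integral>\<^sup>+\<mu>. ennreal (prob (traj (col \<mu>))) \<partial>count_space (S a))" for a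
  proof -
    have "ennreal (r a) = emeasure \<Omega> {\<omega> \<in> space \<Omega>. X 1 \<omega> = a}"
      by (simp add: r_def emeasure_eq_measure)
    also have "\<dots> = emeasure \<Omega> (\<Union>\<mu>\<in>S a. traj (col \<mu>))"
    proof (rule emeasure_eq_AE)
      show "AE \<omega> in \<Omega>. \<omega> \<in> {\<omega> \<in> space \<Omega>. X 1 \<omega> = a} \<longleftrightarrow> \<omega> \<in> (\<Union>\<mu>\<in>S a. traj (col \<mu>))"
        using partition AE_space
      proof eventually_elim
        case (elim \<omega>)
        then obtain \<mu> where \<mu>: "is_partition \<mu>" "\<And>i. i \<ge> 1 \<Longrightarrow> col \<mu> i = X i \<omega>" by blast
        have "\<omega> \<in> traj (col \<mu>)" using \<mu>(2) elim(2) by (simp add: traj_def)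
        moreover have "\<mu> \<in> S (X 1 \<omega>)"
          using \<mu>(2)[of 1] col_1[OF \<mu>(1)] \<mu>(1) by (simp add: S_def)
        moreover have "X 1 \<omega> = a" if "\<nu> \<in> S a" "\<omega> \<in> traj (col \<nu>)" for \<nu>
          using that col_1[of \<nu>] by (simp add: traj_def S_def)
        ultimately show ?case using elim(2) by auto
      qed
    qed (auto intro!: level_set_measurable sets.countable_UN'' countable_multiset)
    also have "\<dots> = (\<integral>\<^sup>+\<mu>. emeasure \<Omega> (traj (col \<mu>)) \<partial>count_space (S a))"
    proof (rule emeasure_UN_countable)
      show "disjoint_family_on (\<lambda>\<mu>. traj (col \<mu>)) (S a)"
      proof (unfold disjoint_family_on_def, intro ballI impI)
        fix \<mu> \<nu> assume *: "\<mu> \<in> S a" "\<nu> \<in> S a" "\<mu> \<noteq> \<nu>"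
        then obtain i where "i \<ge> 1" "col \<mu> i \<noteq> col \<nu> i"
          using partition_eqI[of \<mu> \<nu>] by (auto simp: S_def)
        then show "traj (col \<mu>) \<inter> traj (col \<nu>) = {}" by (auto simp: traj_def)
      qed
    qed (auto intro: countable_multiset)
    finally show ?thesis by (simp add: emeasure_eq_measure)
  qed
  have "prob (traj (col \<mu>)) = M_Sp_weight Q u \<mu>" if \<mu>: "is_partition \<mu>" for \<mu>
  proof -
    define a where "a = size \<mu>"
    have \<mu>_S: "\<mu> \<in> S a" using \<mu> by (simp add: S_def a_def)
    have nonneg: "C \<ge> 0" "P'_Sp Q u a > 0" "r a \<ge> 0" "M_Sp_weight Q u \<mu> \<ge> 0"
      using prodinf_M_Sp_nonneg[OF Q, of u] P'_Sp_pos[OF Q u] M_Sp_weight_nonneg[OF Q u \<mu>] u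
      by (auto simp: C_def r_def)
    show ?thesis
    proof (cases "r a = 0")
      case True
      \<comment> \<open>\<open>r a\<close> is the total over \<open>S a\<close> of both the weights
        and the path probabilities; if it vanishes, so does every single term.\<close>
      have "(\<integral>\<^sup>+\<mu>. ennreal (M_Sp_weight Q u \<mu>) \<partial>count_space (S a)) = 0"
        "(\<integral>\<^sup>+\<mu>. ennreal (prob (traj (col \<mu>))) \<partial>count_space (S a)) = 0"
        using True r[of a] first_col[of a] P_Sp_eq_nn_integral[of Q u a] by (simp_all add: S_def)
      then have "M_Sp_weight Q u \<mu> \<le> 0" "prob (traj (col \<mu>)) \<le> 0"
        using \<mu>_S by (simp_all add: nn_integral_0_iff_AE AE_count_space ennreal_eq_0_iff)
      then show ?thesis using nonneg(4) by (simp add: measure_le_0_iff)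
    next
      case False
      \<comment> \<open>Summing \<open>traj_prob\<close> over \<open>S a\<close> gives
        \<open>P'_Sp Q u a * C * r a\<close> on one side by \<open>first_col\<close>, and
        \<open>r a * r a\<close> on the other by \<open>P_Sp_eq_nn_integral\<close>; cancelling
        \<open>r a\<close> identifies the constant.\<close>
      have "ennreal (P'_Sp Q u a * C) * ennreal (r a) =
          (\<integral>\<^sup>+\<mu>. ennreal (P'_Sp Q u a * C * prob (traj (col \<mu>))) \<partial>count_space (S a))"
        using nonneg by (simp add: first_col nn_integral_cmult ennreal_mult')
      also have "\<dots> = (\<integral>\<^sup>+\<mu>. ennreal (r a * M_Sp_weight Q u \<mu>) \<partial>count_space (S a))"
        by (intro nn_integral_cong) (auto simp: S_def simp flip: traj_prob)
      also have "\<dots> = ennreal (r a) * ennreal (r a)"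
        using nonneg
        by (simp add: nn_integral_cmult ennreal_mult' S_def flip: r P_Sp_eq_nn_integral)
      finally have "P'_Sp Q u a * C * r a = r a * r a"
        using nonneg by (simp flip: ennreal_mult)
      then have "P'_Sp Q u a * C = r a" using False by simp
      then show ?thesis using traj_prob[OF \<mu>] False by (simp add: a_def)
    qed
  qed
  moreover have "traj (col \<mu>) = {\<omega> \<in> space \<Omega>. \<forall>i\<ge>1. col \<mu> i = X i \<omega>}" for \<mu>
    by (auto simp: traj_def)
  moreover have "AE \<omega> in \<Omega>. \<exists>!\<mu>. is_partition \<mu> \<and> (\<forall>i\<ge>1. col \<mu> i = X i \<omega>)"
    using partition by eventually_elim (metis partition_eqI)
  ultimately show ?thesis by (simp add: Q_def)
qed

end
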